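(* Let $2<p<\infty$, let $a=\{a_n\}_{n\ge 0}$ be a sequence of complex numbers, and let $T_a:L^p[0,1]\to L^2[0,1]$ be a bounded Walsh multiplier with symbol $a$. Then $T_a$ is compact if and only if $a_n\to 0$ as $n\to\infty$.
   Context: All function spaces consist of complex-valued functions on $[0,1]$ with Lebesgue measure. For $k\in\mathbb{N}_0=\{0,1,2,\dots\}$ the Rademacher functions are $r_k(x)=\operatorname{sign}(\sin(2^{k+1}\pi x))$, $x\in[0,1)$. If $n=\sum_{k=0}^m b_k2^k$ with $b_k\in\{0,1\}$ is the dyadic expansion of $n\in\mathbb{N}_0$, the Walsh(-Paley) function is $W_n(x)=\prod_{k=0}^m r_k(x)^{b_k}$ (with $W_0=1$). The Walsh functions take values $\pm1$ a.e. and form an orthonormal system in $L^2[0,1]$. For $f\in L^1[0,1]$ the Walsh-Fourier coefficients are $\hat f(n)=\int_0^1 f(x)W_n(x)\,dx$, $n\in\mathbb{N}_0$. For $1<p<\infty$ the Walsh system (in the order $n=0,1,2,\dots$) is a Schauder basis of $L^p[0,1]$, so $f=\sum_{n\ge0}\hat f(n)W_n$ in $L^p$ norm. The Walsh multiplier operator with symbol $a=\{a_n\}_{n\ge0}$ is given by $T_af=\sum_{n=0}^\infty a_n\hat f(n)W_n$. That $T_a:L^p[0,1]\to L^2[0,1]$ is a bounded Walsh multiplier means that this formula defines a bounded linear operator from $L^p[0,1]$ to $L^2[0,1]$ (equivalently, $T_a$ is the bounded linear operator from $L^p[0,1]$ to $L^2[0,1]$ with $T_aW_n=a_nW_n$ for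 all $n$). *)

theory Defs
  imports "HOL-Analysis.Analysis"
begin

section \<open>Measurable functions on the unit interval modulo null sets\<close>

abbreviation unit_leb :: "real measure" where
  "unit_leb \<equiv> lebesgue_on {0..1}"

definition ae_eq :: "(real \<Rightarrow> complex) \<Rightarrow> (real \<Rightarrow> complex) \<Rightarrow> bool" where
  "ae_eq f g \<longleftrightarrow> f \<in> borel_measurable unit_leb \<and> g \<in> borel_measurable unit_leb
     \<and> (AE x in unit_leb. f x = g x)"

lemma part_equivp_ae_eq: "part_equivp ae_eq"
proof (rule part_equivpI)
  show "\<exists>x. ae_eq x x"
    by (rule exI[of _ "\<lambda>_. 0"]) (simp add: ae_eq_def)
  show "symp ae_eq"
    by (rule sympI) (auto simp: ae_eq_def elim: AE_mp)
  show "transp ae_eq"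
  proof (rule transpI)
    fix f g h assume a: "ae_eq f g" "ae_eq g h"
    have "AE x in unit_leb. f x = h x"
      using a unfolding ae_eq_def by (auto elim: AE_mp)
    then show "ae_eq f h" using a by (simp add: ae_eq_def)
  qed
qed

quotient_type ae_fun = "real \<Rightarrow> complex" / partial: ae_eq
  by (rule part_equivp_ae_eq)

instantiation ae_fun :: ab_group_add
begin

lift_definition zero_ae_fun :: ae_fun is "\<lambda>_. 0"
  by (simp add: ae_eq_def)

lift_definition plus_ae_fun :: "ae_fun \<Rightarrow> ae_fun \<Rightarrow> ae_fun" is "\<lambda>f g x. f x + g x"
  unfolding ae_eq_def by (auto elim: AE_mp)

lift_definition minus_ae_fun :: "ae_fun \<Rightarrow> ae_fun \<Rightarrow> ae_fun" is "\<lambda>f g x. f x - g x"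
  unfolding ae_eq_def by (auto elim: AE_mp)

lift_definition uminus_ae_fun :: "ae_fun \<Rightarrow> ae_fun" is "\<lambda>f x. - f x"
  unfolding ae_eq_def by (auto elim: AE_mp)

instance
  by standard (transfer; simp add: ae_eq_def algebra_simps)+

end

lift_definition scale_ae :: "complex \<Rightarrow> ae_fun \<Rightarrow> ae_fun" is "\<lambda>c f x. c * f x"
  unfolding ae_eq_def by (auto elim: AE_mp)

interpretation ae_fun: vector_space scale_ae
  by standard (transfer; simp add: ae_eq_def algebra_simps)+


section \<open>The spaces \<open>L\<^sup>p[0,1]\<close>\<close>

lift_definition Lp_norm :: "real \<Rightarrow> ae_fun \<Rightarrow> real" is
  "\<lambda>p f. (LINT x|unit_leb. norm (f x) powr p) powr (1 / p)"
  unfolding ae_eq_def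
  by (intro arg_cong[where f = "\<lambda>t. t powr _"] integral_cong_AE) (auto elim: AE_mp)

lift_definition in_Lp :: "real \<Rightarrow> ae_fun \<Rightarrow> bool" is
  "\<lambda>p f. integrable unit_leb (\<lambda>x. norm (f x) powr p)"
  unfolding ae_eq_def
  by (intro integrable_cong_AE) (auto elim: AE_mp)

definition Lp :: "real \<Rightarrow> ae_fun set" where
  "Lp p = {f. in_Lp p f}"

definition Lp_topology :: "real \<Rightarrow> ae_fun topology" where
  "Lp_topology p = Metric_space.mtopology (Lp p) (\<lambda>f g. Lp_norm p (f - g))"

text \<open>Minkowski's inequality: for \<open>p \<ge> 1\<close> the set \<open>Lp p\<close> is a linear subspace and
  \<open>Lp_norm p\<close> is a norm on it, so that \<open>Lp_topology p\<close> is the norm topology.\<close>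

lemma powr_add_le_weighted:
  fixes u v A B p :: real
  assumes p: "p \<ge> 1" and uv: "u \<ge> 0" "v \<ge> 0" and AB: "A > 0" "B > 0"
  shows "(u + v) powr p \<le> (A + B) powr p *
    (A / (A + B) * (u powr p / A powr p) + B / (A + B) * (v powr p / B powr p))"
proof -
  have mono: "(y / (A + B)) powr p \<le> C / (A + B) * (y powr p / C powr p)"
    if C: "C > 0" "C \<le> A + B" and y: "y \<ge> 0" for C y
  proof -
    have "(C / (A + B)) powr p \<le> (C / (A + B)) powr 1"
      using C p AB by (intro powr_mono') auto
    then have "(C / (A + B)) powr p * (y / C) powr p \<le> C / (A + B) * (y / C) powr p"
      using C AB by (intro mult_right_mono) auto
    moreover have "(C / (A + B)) powr p * (y / C) powr p = (y / (A + B)) powr p"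
      using C AB y by (simp add: powr_mult[symmetric])
    ultimately show ?thesis using C y by (simp add: powr_divide)
  qed
  have "((u + v) / (A + B)) powr p \<le>
    A / (A + B) * (u powr p / A powr p) + B / (A + B) * (v powr p / B powr p)"
  proof (cases "u = 0 \<or> v = 0")
    case True
    then show ?thesis using mono[of A u] mono[of B v] uv AB p by auto
  next
    case False
    then have pos: "u / A > 0" "v / B > 0" using uv AB by auto
    have eq: "A / (A + B) * (u / A) + B / (A + B) * (v / B) = (u + v) / (A + B)"
      using AB by (simp add: add_divide_distrib)
    have "(A / (A + B) * (u / A) + B / (A + B) * (v / B)) powr p
      \<le> A / (A + B) * (u / A) powr p + B / (A + B) * (v / B) powr p"
      using convex_onD[OF powr_convex[OF p], of "B / (A + B)" "u / A" "v / B"] pos AB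
      by (simp add: field_simps)
    then show ?thesis unfolding eq using uv AB by (simp add: powr_divide)
  qed
  moreover have "((u + v) / (A + B)) powr p = (u + v) powr p / (A + B) powr p"
    using uv AB by (simp add: powr_divide)
  ultimately show ?thesis using AB by (simp add: divide_le_eq mult.commute)
qed

lemma Lp_norm_nonneg: "Lp_norm p f \<ge> 0"
  by transfer simp

lemma Lp_norm_zero_iff:
  assumes "p \<ge> 1" "in_Lp p f"
  shows "Lp_norm p f = 0 \<longleftrightarrow> f = 0"
  using assms
proof transfer
  fix p :: real and f :: "real \<Rightarrow> complex"
  assume p: "1 \<le> p" and f: "ae_eq f f" and int: "integrable unit_leb (\<lambda>x. norm (f x) powr p)"
  have "(LINT x|unit_leb. norm (f x) powr p) = 0 \<longleftrightarrow> (AE x in unit_leb. norm (f x) powr p = 0)"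
    using int by (intro integral_nonneg_eq_0_iff_AE) auto
  then show "((LINT x|unit_leb. norm (f x) powr p) powr (1 / p) = 0) = ae_eq f (\<lambda>_. 0)"
    using f by (simp add: ae_eq_def)
qed

lemma Lp_norm_scale:
  assumes "p \<ge> 1"
  shows "Lp_norm p (scale_ae c f) = norm c * Lp_norm p f"
  using assms
  by transfer (simp add: norm_mult powr_mult powr_powr)

lemma in_Lp_scale: "in_Lp p f \<Longrightarrow> in_Lp p (scale_ae c f)"
  by transfer (simp add: norm_mult powr_mult)

lemma in_Lp_zero: "in_Lp p 0"
  by transfer simp

lemma Minkowski_aux:
  assumes "p \<ge> 1" "in_Lp p f" "in_Lp p g" "A > 0" "B > 0" "Lp_norm p f \<le> A" "Lp_norm p g \<le> B"
  shows "in_Lp p (f + g) \<and> Lp_norm p (f + g) \<le> A + B"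
  using assms
proof transfer
  fix p A B :: real and f g :: "real \<Rightarrow> complex"
  assume p: "1 \<le> p" and fg: "ae_eq f f" "ae_eq g g" and AB: "A > 0" "B > 0"
    and int: "integrable unit_leb (\<lambda>x. norm (f x) powr p)"
      "integrable unit_leb (\<lambda>x. norm (g x) powr p)"
    and le: "(LINT x|unit_leb. norm (f x) powr p) powr (1 / p) \<le> A"
      "(LINT x|unit_leb. norm (g x) powr p) powr (1 / p) \<le> B"
  let ?I = "\<lambda>h::real \<Rightarrow> complex. LINT x|unit_leb. norm (h x) powr p"
  let ?b = "\<lambda>x. (A + B) powr p * (A / (A + B) * (norm (f x) powr p / A powr p)
    + B / (A + B) * (norm (g x) powr p / B powr p))"
  have le_powr: "?I h \<le> C powr p" if "?I h powr (1 / p) \<le> C" for h C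
    using powr_mono2[OF _ _ that, of p] p by (simp add: powr_powr)
  have pt: "norm (f x + g x) powr p \<le> ?b x" for x
    using powr_add_le_weighted[OF p, of "norm (f x)" "norm (g x)" A B] AB p
      powr_mono2[of p "norm (f x + g x)" "norm (f x) + norm (g x)"] norm_triangle_ineq[of "f x" "g x"]
    by simp
  have intb: "integrable unit_leb ?b" using int by auto
  have 1: "integrable unit_leb (\<lambda>x. norm (f x + g x) powr p)"
  proof (rule Bochner_Integration.integrable_bound[OF intb])
    show "(\<lambda>x. norm (f x + g x) powr p) \<in> borel_measurable unit_leb"
      using fg by (auto simp: ae_eq_def)
    show "AE x in unit_leb. norm (norm (f x + g x) powr p) \<le> norm (?b x)"
      using pt by (intro AE_I2) (smt (verit, best) powr_ge_zero real_norm_def)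
  qed
  have "?I (\<lambda>x. f x + g x) \<le> (LINT x|unit_leb. ?b x)"
    using 1 intb pt by (intro integral_mono) auto
  also have "\<dots> = (A + B) powr p * (A / (A + B) * (?I f / A powr p) + B / (A + B) * (?I g / B powr p))"
    using int by simp
  also have "\<dots> \<le> (A + B) powr p * (A / (A + B) * 1 + B / (A + B) * 1)"
    using AB le_powr[OF le(1)] le_powr[OF le(2)]
    by (intro mult_left_mono add_mono) (auto simp: divide_le_eq)
  also have "\<dots> = (A + B) powr p" using AB by (simp add: add_divide_distrib[symmetric])
  finally have "?I (\<lambda>x. f x + g x) powr (1 / p) \<le> ((A + B) powr p) powr (1 / p)"
    using p by (intro powr_mono2) auto
  then have "?I (\<lambda>x. f x + g x) powr (1 / p) \<le> A + B" using p AB by (simp add: powr_powr)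
  with 1 show "integrable unit_leb (\<lambda>x. norm (f x + g x) powr p) \<and>
      ?I (\<lambda>x. f x + g x) powr (1 / p) \<le> A + B" by simp
qed

lemma in_Lp_add: "p \<ge> 1 \<Longrightarrow> in_Lp p f \<Longrightarrow> in_Lp p g \<Longrightarrow> in_Lp p (f + g)"
  using Minkowski_aux[of p f g "Lp_norm p f + 1" "Lp_norm p g + 1"]
    Lp_norm_nonneg[of p f] Lp_norm_nonneg[of p g] by simp

lemma Lp_norm_triangle:
  assumes "p \<ge> 1" "in_Lp p f" "in_Lp p g"
  shows "Lp_norm p (f + g) \<le> Lp_norm p f + Lp_norm p g"
proof (rule field_le_epsilon)
  fix e :: real assume "e > 0"
  then show "Lp_norm p (f + g) \<le> Lp_norm p f + Lp_norm p g + e"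
    using Minkowski_aux[OF assms, of "Lp_norm p f + e / 2" "Lp_norm p g + e / 2"]
      Lp_norm_nonneg[of p f] Lp_norm_nonneg[of p g] by simp
qed

lemma subspace_Lp: "p \<ge> 1 \<Longrightarrow> ae_fun.subspace (Lp p)"
  by (auto simp: ae_fun.subspace_def Lp_def in_Lp_zero in_Lp_add in_Lp_scale)

lemma Metric_space_Lp:
  assumes "p \<ge> 1"
  shows "Metric_space (Lp p) (\<lambda>f g. Lp_norm p (f - g))"
proof
  fix f g h
  show "0 \<le> Lp_norm p (f - g)" by (rule Lp_norm_nonneg)
  have "g - f = scale_ae (-1) (f - g)" by simp
  then show "Lp_norm p (f - g) = Lp_norm p (g - f)"
    by (simp only: Lp_norm_scale[OF assms]) simp
  assume fg: "f \<in> Lp p" "g \<in> Lp p"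
  then have d: "in_Lp p (f - g)"
    using ae_fun.subspace_diff[OF subspace_Lp[OF assms] fg] by (simp add: Lp_def)
  then show "Lp_norm p (f - g) = 0 \<longleftrightarrow> f = g" by (simp add: Lp_norm_zero_iff[OF assms])
  assume "h \<in> Lp p"
  then have "in_Lp p (g - h)"
    using ae_fun.subspace_diff[OF subspace_Lp[OF assms], of g h] fg by (simp add: Lp_def)
  from Lp_norm_triangle[OF assms d this]
  show "Lp_norm p (f - h) \<le> Lp_norm p (f - g) + Lp_norm p (g - h)" by simp
qed


section \<open>Walsh functions and Walsh multipliers\<close>

definition rademacher :: "nat \<Rightarrow> real \<Rightarrow> real" where
  "rademacher k x = sgn (sin (2 ^ (k + 1) * pi * x))"

text \<open>The product runs over the finitely many binary digits of \<open>n\<close> that are equal to \<open>1\<close>.\<close>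

definition walsh :: "nat \<Rightarrow> real \<Rightarrow> real" where
  "walsh n x = (\<Prod>k | bit n k. rademacher k x)"

lemma finite_bits: "finite {k. bit (n::nat) k}"
proof -
  have "{k. bit n k} \<subseteq> {..<n}"
  proof
    fix k assume "k \<in> {k. bit n k}"
    then have "2 ^ k \<le> n" by (metis bit_nat_def div_less even_zero mem_Collect_eq not_less)
    then show "k \<in> {..<n}" by (meson lessThan_iff less_exp less_le_trans)
  qed
  then show ?thesis by (rule finite_subset) simp
qed

lemma measurable_walsh [measurable]: "walsh n \<in> borel_measurable unit_leb"
proof -
  have "walsh n \<in> borel_measurable borel"
    unfolding walsh_def rademacher_def by measurable
  then show ?thesis
    by (intro measurable_restrict_space1 measurable_completion) simp
qed

lift_definition walsh_ae :: "nat \<Rightarrow> ae_fun" is "\<lambda>n x. of_real (walsh n x)"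
  by (simp add: ae_eq_def)

lift_definition walsh_coeff :: "ae_fun \<Rightarrow> nat \<Rightarrow> complex" is
  "\<lambda>f n. LINT x|unit_leb. f x * of_real (walsh n x)"
  unfolding ae_eq_def
  by (intro ext integral_cong_AE) (auto elim: AE_mp)

definition multiplier_partial_sum :: "(nat \<Rightarrow> complex) \<Rightarrow> ae_fun \<Rightarrow> nat \<Rightarrow> ae_fun" where
  "multiplier_partial_sum a f N = (\<Sum>n<N. scale_ae (a n * walsh_coeff f n) (walsh_ae n))"

text \<open>Operators between Lebesgue spaces are total functions on \<^typ>\<open>ae_fun\<close> of which only the
  values on the domain \<open>Lp p\<close> matter.\<close>

definition bounded_linear_Lp :: "real \<Rightarrow> real \<Rightarrow> (ae_fun \<Rightarrow> ae_fun) \<Rightarrow> bool" where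
  "bounded_linear_Lp p q T \<longleftrightarrow>
     (\<forall>f\<in>Lp p. T f \<in> Lp q) \<and>
     (\<forall>f\<in>Lp p. \<forall>g\<in>Lp p. T (f + g) = T f + T g) \<and>
     (\<forall>c. \<forall>f\<in>Lp p. T (scale_ae c f) = scale_ae c (T f)) \<and>
     (\<exists>C. \<forall>f\<in>Lp p. Lp_norm q (T f) \<le> C * Lp_norm p f)"

text \<open>The series \<open>T f = (\<Sum>n. a n * walsh_coeff f n * walsh n)\<close> converges in the norm of
  the target space.\<close>

definition bounded_walsh_multiplier ::
  "real \<Rightarrow> real \<Rightarrow> (nat \<Rightarrow> complex) \<Rightarrow> (ae_fun \<Rightarrow> ae_fun) \<Rightarrow> bool" where
  "bounded_walsh_multiplier p q a T \<longleftrightarrow>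
     bounded_linear_Lp p q T \<and>
     (\<forall>f\<in>Lp p. (\<lambda>N. Lp_norm q (multiplier_partial_sum a f N - T f)) \<longlonglongrightarrow> 0)"

definition compact_operator_Lp :: "real \<Rightarrow> real \<Rightarrow> (ae_fun \<Rightarrow> ae_fun) \<Rightarrow> bool" where
  "compact_operator_Lp p q T \<longleftrightarrow>
     compactin (Lp_topology q)
       (Lp_topology q closure_of (T ` {f \<in> Lp p. Lp_norm p f \<le> 1}))"

end

theory Submission
  imports Defs
begin

text \<open>
  Since \<open>L\<^sup>2\<close> is complete (\<open>mcomplete_Lp\<close>), the operator \<open>T\<close> is compact if and only if the image of the
  unit ball of \<open>L\<^sup>p\<close> is totally bounded (\<open>compact_operator_Lp_iff_totally_bounded\<close>). Everything else
  is a computation with the orthonormal Walsh system (\<open>L2_inner_walsh\<close>).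

  If infinitely many \<open>a n\<close> have modulus at least \<open>e > 0\<close>, then the image of the unit ball contains
  the corresponding vectors \<open>T (walsh_ae n) = scale_ae (a n) (walsh_ae n)\<close>
  (\<open>multiplier_walsh\<close>), because Walsh functions are bounded by one and so have \<open>L\<^sup>p\<close> norm at most one.
  These vectors are orthogonal, hence any two of them are at distance at least \<open>e\<close>, and the image
  is not totally bounded.

  If \<open>a\<close> tends to zero, then \<open>T\<close> is a limit of finite-rank operators, uniformly on the unit
  ball. A function in that ball has \<open>L\<^sup>2\<close> norm at most one (\<open>Lp_norm_exponent_mono\<close>, which is where
  \<open>2 < p\<close> enters), so by Parseval and Bessel cutting the series off at \<open>N\<close> changes \<open>T f\<close> by at
  most the supremum of \<open>norm (a n)\<close> over \<open>n \<ge> N\<close> (\<open>multiplier_tail_bound\<close>). What is left are Walsh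
  sums of length \<open>N\<close> with bounded coefficients, and these have finite nets
  (\<open>walsh_sum_finite_net\<close>).
\<close>

section \<open>Lebesgue spaces with different exponents\<close>

text \<open>The inclusion \<open>L\<^sup>p \<subseteq> L\<^sup>q\<close> on a probability space, with norm at most one, follows by integrating
  this form of Young's inequality with \<open>u = norm (f x) / A\<close>: the two weights on the right
  add up to one, so if the \<open>p\<close>-th power of \<open>u\<close> has integral at most one, then so does the \<open>q\<close>-th.\<close>

lemma powr_le_weighted_powr:
  fixes u p q :: real
  assumes "u \<ge> 0" "0 < q" "q \<le> p"
  shows "u powr q \<le> q / p * u powr p + (1 - q / p)"
proof (cases "u = 0")
  case False
  with assms show ?thesis
    using Youngs_inequality_0[of "q / p" "1 - q / p" "u powr p" 1] by (simp add: powr_powr)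
qed (use assms in auto)

text \<open>The bound \<open>A\<close> in place of the norm itself avoids dividing by a norm that may vanish.\<close>

lemma Lp_norm_exponent_mono_aux:
  assumes "0 < q" "q \<le> p" "in_Lp p f" "A > 0" "Lp_norm p f \<le> A"
  shows "in_Lp q f \<and> Lp_norm q f \<le> A"
  using assms
proof transfer
  fix p q A :: real and f :: "real \<Rightarrow> complex"
  assume q: "0 < q" "q \<le> p" and f: "ae_eq f f" and A: "A > 0"
    and int: "integrable unit_leb (\<lambda>x. norm (f x) powr p)"
    and le: "(LINT x|unit_leb. norm (f x) powr p) powr (1 / p) \<le> A"
  let ?b = "\<lambda>x. A powr q * (q / p * (norm (f x) powr p / A powr p) + (1 - q / p))"
  have prob: "measure unit_leb {0..1} = 1" "space unit_leb = {0..1}"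
    by (simp_all add: measure_restrict_space)
  have le_powr: "(LINT x|unit_leb. norm (f x) powr p) \<le> A powr p"
    using powr_mono2[OF _ _ le, of p] q by (simp add: powr_powr)
  have pt: "norm (f x) powr q \<le> ?b x" for x
  proof -
    have "(norm (f x) / A) powr q \<le> q / p * (norm (f x) / A) powr p + (1 - q / p)"
      using A q by (intro powr_le_weighted_powr) auto
    then show ?thesis using A by (simp add: powr_divide divide_le_eq mult.commute)
  qed
  have intc: "integrable unit_leb (\<lambda>x. c)" for c :: real
    by (intro finite_measure.integrable_const finite_measureI) (simp add: emeasure_restrict_space)
  have intb: "integrable unit_leb ?b" using int intc by auto
  have 1: "integrable unit_leb (\<lambda>x. norm (f x) powr q)"
  proof (rule Bochner_Integration.integrable_bound[OF intb])
    show "(\<lambda>x. norm (f x) powr q) \<in> borel_measurable unit_leb"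
      using f by (auto simp: ae_eq_def)
    show "AE x in unit_leb. norm (norm (f x) powr q) \<le> norm (?b x)"
      using pt by (intro AE_I2) (smt (verit, best) powr_ge_zero real_norm_def)
  qed
  have "(LINT x|unit_leb. norm (f x) powr q) \<le> (LINT x|unit_leb. ?b x)"
    using 1 intb pt by (intro integral_mono) auto
  also have "\<dots> = A powr q * (q / p * ((LINT x|unit_leb. norm (f x) powr p) / A powr p) + (1 - q / p))"
    using int intc prob by simp
  also have "\<dots> \<le> A powr q * (q / p * 1 + (1 - q / p))"
    using q A le_powr by (intro mult_left_mono add_mono) (auto simp: divide_le_eq)
  finally have "(LINT x|unit_leb. norm (f x) powr q) \<le> A powr q" by simp
  then have "(LINT x|unit_leb. norm (f x) powr q) powr (1 / q) \<le> (A powr q) powr (1 / q)"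
    using q by (intro powr_mono2) auto
  with 1 show "integrable unit_leb (\<lambda>x. norm (f x) powr q) \<and>
      (LINT x|unit_leb. norm (f x) powr q) powr (1 / q) \<le> A"
    using q A by (simp add: powr_powr)
qed

lemma in_Lp_exponent_mono: "0 < q \<Longrightarrow> q \<le> p \<Longrightarrow> in_Lp p f \<Longrightarrow> in_Lp q f"
  using Lp_norm_exponent_mono_aux[of q p f "Lp_norm p f + 1"] Lp_norm_nonneg[of p f] by simp

lemma Lp_norm_exponent_mono:
  assumes "0 < q" "q \<le> p" "in_Lp p f"
  shows "Lp_norm q f \<le> Lp_norm p f"
proof (rule field_le_epsilon)
  fix e :: real assume "e > 0"
  then show "Lp_norm q f \<le> Lp_norm p f + e"
    using Lp_norm_exponent_mono_aux[OF assms, of "Lp_norm p f + e"] Lp_norm_nonneg[of p f] by simp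
qed

lemma in_Lp_diff: "p \<ge> 1 \<Longrightarrow> in_Lp p f \<Longrightarrow> in_Lp p g \<Longrightarrow> in_Lp p (f - g)"
  using ae_fun.subspace_diff[OF subspace_Lp, of p f g] by (simp add: Lp_def)

lemma Lp_norm_minus_commute: "Lp_norm p (f - g) = Lp_norm p (g - f)"
  by transfer (simp add: norm_minus_commute)

section \<open>Completeness of \<open>L\<^sup>p\<close>\<close>

text \<open>By monotone convergence the sum of all steps has a finite integral, so it is finite
  almost everywhere, and there the telescoping series converges absolutely.\<close>

lemma AE_convergent_if_summable_L1_steps:
  fixes F :: "nat \<Rightarrow> 'a \<Rightarrow> 'b :: {banach, second_countable_topology}"
  assumes [measurable]: "\<And>k. F k \<in> borel_measurable M"
    and int: "\<And>k. integrable M (\<lambda>x. norm (F (Suc k) x - F k x))"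
    and le: "\<And>k. (LINT x|M. norm (F (Suc k) x - F k x)) \<le> b k" and b: "summable b"
  shows "AE x in M. convergent (\<lambda>k. F k x)"
proof -
  let ?d = "\<lambda>k x. norm (F (Suc k) x - F k x)"
  have b0: "0 \<le> b k" for k by (rule order_trans[OF _ le[of k]]) simp
  have "(\<integral>\<^sup>+x. (\<Sum>k. ennreal (?d k x)) \<partial>M) = (\<Sum>k. \<integral>\<^sup>+x. ?d k x \<partial>M)"
    by (rule nn_integral_suminf) measurable
  also have "\<dots> \<le> (\<Sum>k. ennreal (b k))"
    using int le by (intro suminf_le) (auto simp: nn_integral_eq_integral ennreal_leI)
  also have "\<dots> = ennreal (suminf b)" using b b0 by (intro suminf_ennreal2) auto
  finally have "(\<integral>\<^sup>+x. (\<Sum>k. ennreal (?d k x)) \<partial>M) \<noteq> \<infinity>" by (auto simp: top_unique)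
  then have "AE x in M. (\<Sum>k. ennreal (?d k x)) \<noteq> \<infinity>"
    by (intro nn_integral_PInf_AE) measurable
  then show ?thesis
  proof eventually_elim
    case (elim x)
    then have "summable (\<lambda>k. ?d k x)" by (intro summable_suminf_not_top) auto
    then have "summable (\<lambda>k. F (Suc k) x - F k x)" by (rule summable_norm_cancel)
    then have "convergent (\<lambda>n. F n x - F 0 x)"
      by (simp add: summable_iff_convergent sum_lessThan_telescope[of "\<lambda>n. F n x"])
    then show ?case using convergent_add_const_right_iff[of "\<lambda>n. F n x" "- F 0 x"] by simp
  qed
qed

text \<open>Fatou's lemma as it is used below: a bound on the \<open>L\<^sup>p\<close> norms survives pointwise
  limits, and the limit function is in \<open>L\<^sup>p\<close> to begin with.\<close>

lemma Fatou_powr: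
  fixes h :: "nat \<Rightarrow> 'a \<Rightarrow> 'b :: {banach, second_countable_topology}"
  assumes [measurable]: "\<And>j. h j \<in> borel_measurable M" "g \<in> borel_measurable M"
    and lim: "AE x in M. (\<lambda>j. h j x) \<longlonglongrightarrow> g x" and "0 < p" "0 \<le> B"
    and ev: "\<forall>\<^sub>F j in sequentially. integrable M (\<lambda>x. norm (h j x) powr p)
      \<and> (LINT x|M. norm (h j x) powr p) \<le> B"
  shows "integrable M (\<lambda>x. norm (g x) powr p) \<and> (LINT x|M. norm (g x) powr p) \<le> B"
proof -
  have "(\<integral>\<^sup>+x. norm (g x) powr p \<partial>M) = (\<integral>\<^sup>+x. liminf (\<lambda>j. ennreal (norm (h j x) powr p)) \<partial>M)"
  proof (rule nn_integral_cong_AE, use lim in eventually_elim)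
    case (elim x)
    have "(\<lambda>j. ennreal (norm (h j x) powr p)) \<longlonglongrightarrow> ennreal (norm (g x) powr p)"
      using elim \<open>0 < p\<close> by (intro tendsto_ennrealI tendsto_powr2 tendsto_norm) auto
    then show ?case by (intro lim_imp_Liminf[symmetric]) auto
  qed
  also have "\<dots> \<le> liminf (\<lambda>j. \<integral>\<^sup>+x. norm (h j x) powr p \<partial>M)"
    by (rule nn_integral_liminf) measurable
  also have "\<dots> \<le> limsup (\<lambda>j. \<integral>\<^sup>+x. norm (h j x) powr p \<partial>M)"
    by (rule Liminf_le_Limsup) simp
  also have "\<dots> \<le> ennreal B"
    using ev by (intro Limsup_bounded, elim eventually_mono)
      (auto simp: nn_integral_eq_integral ennreal_leI)
  finally have le: "(\<integral>\<^sup>+x. norm (g x) powr p \<partial>M) \<le> ennreal B" .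
  then have int: "integrable M (\<lambda>x. norm (g x) powr p)"
    by (intro integrableI_bounded) (auto simp: top_unique less_top[symmetric])
  with le \<open>0 \<le> B\<close> show ?thesis by (simp add: nn_integral_eq_integral)
qed

lemma ae_fun_representative:
  obtains h where "ae_eq h h" "f = abs_ae_fun h"
  using Quotient3_ae_fun
  by (metis Quotient3_abs_rep Quotient3_rep_reflp)

text \<open>The Riesz-Fischer theorem. A subsequence whose steps decrease geometrically in \<open>L\<^sup>p\<close> does so
  in \<open>L\<^sup>1\<close> as well, hence converges almost everywhere; Fatou's lemma shows that its pointwise limit
  is its limit in \<open>L\<^sup>p\<close>, and a Cauchy sequence converges once a subsequence does.\<close>

theorem mcomplete_Lp:
  assumes p: "p \<ge> 1"
  shows "Metric_space.mcomplete (Lp p) (\<lambda>f g. Lp_norm p (f - g))"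
proof -
  interpret Metric_space "Lp p" "\<lambda>f g. Lp_norm p (f - g)" by (rule Metric_space_Lp[OF p])
  show ?thesis
    unfolding mcomplete_def
  proof (intro allI impI)
    fix \<sigma> assume cau: "MCauchy \<sigma>"
    have mem: "in_Lp p (\<sigma> n)" for n using cau unfolding MCauchy_def by (auto simp: Lp_def)
    have "\<exists>N. \<forall>n m. N \<le> n \<longrightarrow> N \<le> m \<longrightarrow> Lp_norm p (\<sigma> n - \<sigma> m) < (1/2) ^ k" for k :: nat
      using cau by (simp add: MCauchy_def)
    then obtain N where N: "Lp_norm p (\<sigma> n - \<sigma> m) < (1/2) ^ k" if "N k \<le> n" "N k \<le> m" for k n m
      by metis
    \<comment> \<open>Adding \<open>k\<close> to the partial sums makes \<open>r\<close> strictly increasing; the sums keep it above \<open>N\<close>.\<close>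
    define r where "r k = k + (\<Sum>i\<le>k. N i)" for k
    have r: "strict_mono r" by (rule strict_monoI_Suc) (simp add: r_def)
    have Nr: "N k \<le> r k" for k
      unfolding r_def by (intro trans_le_add2 member_le_sum) auto
    have "\<exists>h. ae_eq h h \<and> \<sigma> (r k) = abs_ae_fun h" for k
      by (metis ae_fun_representative)
    then obtain F where F: "\<And>k. ae_eq (F k) (F k)" "\<And>k. \<sigma> (r k) = abs_ae_fun (F k)"
      by metis
    have diff: "\<sigma> (r j) - \<sigma> (r k) = abs_ae_fun (\<lambda>x. F j x - F k x)" for j k
      by (simp add: F minus_ae_fun.abs_eq)
    have aed: "ae_eq (\<lambda>x. F j x - F k x) (\<lambda>x. F j x - F k x)" for j k
      using F(1)[of j] F(1)[of k] by (auto simp: ae_eq_def)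
    have meas [measurable]: "F k \<in> borel_measurable unit_leb" for k
      using F(1)[of k] by (simp add: ae_eq_def)
    have step: "in_Lp 1 (\<sigma> (r (Suc k)) - \<sigma> (r k))"
      "Lp_norm 1 (\<sigma> (r (Suc k)) - \<sigma> (r k)) \<le> (1/2) ^ k" for k
    proof -
      have d: "in_Lp p (\<sigma> (r (Suc k)) - \<sigma> (r k))" by (intro in_Lp_diff p mem)
      show "in_Lp 1 (\<sigma> (r (Suc k)) - \<sigma> (r k))" by (rule in_Lp_exponent_mono[OF _ p d]) simp
      have "r k \<le> r (Suc k)" using r by (simp add: strict_mono_less_eq)
      then show "Lp_norm 1 (\<sigma> (r (Suc k)) - \<sigma> (r k)) \<le> (1/2) ^ k"
        using Lp_norm_exponent_mono[OF _ p d] N[of k "r (Suc k)" "r k"] Nr[of k] by simp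
    qed
    have "AE x in unit_leb. convergent (\<lambda>k. F k x)"
    proof (rule AE_convergent_if_summable_L1_steps)
      show "integrable unit_leb (\<lambda>x. norm (F (Suc k) x - F k x))"
        "(LINT x|unit_leb. norm (F (Suc k) x - F k x)) \<le> (1/2) ^ k" for k
        using step[of k] unfolding diff in_Lp.abs_eq[OF aed] Lp_norm.abs_eq[OF aed] by simp_all
    qed (simp_all add: summable_geometric)
    moreover define G where "G x = lim (\<lambda>k. F k x)" for x
    ultimately have lim: "AE x in unit_leb. (\<lambda>k. F k x) \<longlonglongrightarrow> G x"
      by (auto simp: G_def convergent_LIMSEQ_iff)
    have G [measurable]: "G \<in> borel_measurable unit_leb" unfolding G_def by measurable
    then have aeG: "ae_eq G G" by (simp add: ae_eq_def)
    have aedG: "ae_eq (\<lambda>x. G x - F k x) (\<lambda>x. G x - F k x)" for k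
      by (simp add: ae_eq_def)
    have diffG: "abs_ae_fun G - \<sigma> (r k) = abs_ae_fun (\<lambda>x. G x - F k x)" for k
      by (simp add: F aeG minus_ae_fun.abs_eq)
    have bound: "in_Lp p (abs_ae_fun G - \<sigma> (r k)) \<and> Lp_norm p (abs_ae_fun G - \<sigma> (r k)) \<le> (1/2) ^ k" for k
    proof -
      have "integrable unit_leb (\<lambda>x. norm (G x - F k x) powr p)
        \<and> (LINT x|unit_leb. norm (G x - F k x) powr p) \<le> ((1/2) ^ k) powr p"
      proof (rule Fatou_powr[where h = "\<lambda>j x. F j x - F k x"])
        show "AE x in unit_leb. (\<lambda>j. F j x - F k x) \<longlonglongrightarrow> G x - F k x"
          using lim by eventually_elim (intro tendsto_intros)
        have "integrable unit_leb (\<lambda>x. norm (F j x - F k x) powr p)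
          \<and> (LINT x|unit_leb. norm (F j x - F k x) powr p) \<le> ((1/2) ^ k) powr p" if "k \<le> j" for j
        proof -
          have "r k \<le> r j" using r that by (simp add: strict_mono_less_eq)
          then have "Lp_norm p (\<sigma> (r j) - \<sigma> (r k)) \<le> (1/2) ^ k"
            using N[of k "r j" "r k"] Nr[of k] by simp
          from powr_mono2[OF _ _ this, of p] p
          have "(LINT x|unit_leb. norm (F j x - F k x) powr p) \<le> ((1/2) ^ k) powr p"
            by (simp add: diff Lp_norm.abs_eq[OF aed] powr_powr)
          moreover have "in_Lp p (\<sigma> (r j) - \<sigma> (r k))" by (intro in_Lp_diff p mem)
          ultimately show ?thesis by (simp add: diff in_Lp.abs_eq[OF aed])
        qed
        then show "\<forall>\<^sub>F j in sequentially. integrable unit_leb (\<lambda>x. norm (F j x - F k x) powr p)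
          \<and> (LINT x|unit_leb. norm (F j x - F k x) powr p) \<le> ((1/2) ^ k) powr p"
          unfolding eventually_sequentially by blast
      qed (use p in auto)
      moreover from this have "(LINT x|unit_leb. norm (G x - F k x) powr p) powr (1 / p)
          \<le> (((1/2) ^ k) powr p) powr (1 / p)"
        using p by (intro powr_mono2) auto
      ultimately show ?thesis
        using p by (simp add: diffG in_Lp.abs_eq[OF aedG] Lp_norm.abs_eq[OF aedG] powr_powr)
    qed
    have "in_Lp p (abs_ae_fun G)"
      using in_Lp_add[OF p conjunct1[OF bound[of 0]] mem[of "r 0"]] by simp
    moreover have "(\<lambda>k. Lp_norm p (\<sigma> (r k) - abs_ae_fun G)) \<longlonglongrightarrow> 0"
    proof (rule tendsto_sandwich[OF _ _ tendsto_const])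
      show "(\<lambda>k. (1/2) ^ k :: real) \<longlonglongrightarrow> 0" by (rule LIMSEQ_realpow_zero) auto
    qed (use bound in \<open>auto simp: Lp_norm_nonneg Lp_norm_minus_commute[of p _ "abs_ae_fun G"]\<close>)
    ultimately have "limitin mtopology (\<sigma> \<circ> r) (abs_ae_fun G) sequentially"
      using mem unfolding limitin_metric_dist_null by (simp add: Lp_def)
    then show "\<exists>x. limitin mtopology \<sigma> x sequentially"
      using MCauchy_convergent_subsequence[OF cau r] by blast
  qed
qed

section \<open>The inner product of \<open>L\<^sup>2\<close>\<close>

lemma integrable_bounded_unit_leb:
  fixes f :: "real \<Rightarrow> 'b :: {banach, second_countable_topology}"
  assumes "f \<in> borel_measurable unit_leb" "\<And>x. norm (f x) \<le> B"
  shows "integrable unit_leb f"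
proof -
  interpret finite_measure unit_leb
    by (rule finite_measureI) (simp add: emeasure_restrict_space)
  show ?thesis using assms by (intro integrable_const_bound[where B = B]) auto
qed

lemma borel_measurable_cnj [measurable]: "cnj \<in> borel_measurable borel"
  by (intro borel_measurable_continuous_onI continuous_intros)

lift_definition L2_inner :: "ae_fun \<Rightarrow> ae_fun \<Rightarrow> complex" is
  "\<lambda>f g. LINT x|unit_leb. f x * cnj (g x)"
  unfolding ae_eq_def
  by (intro integral_cong_AE) (auto elim: AE_mp)

lemma integrable_mult_cnj:
  fixes f g :: "'a \<Rightarrow> complex"
  assumes [measurable]: "f \<in> borel_measurable M" "g \<in> borel_measurable M"
    and int: "integrable M (\<lambda>x. norm (f x) powr 2)" "integrable M (\<lambda>x. norm (g x) powr 2)"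
  shows "integrable M (\<lambda>x. f x * cnj (g x))"
proof (rule Bochner_Integration.integrable_bound)
  show "integrable M (\<lambda>x. norm (f x) powr 2 + norm (g x) powr 2)" using int by auto
  have "norm (f x * cnj (g x)) \<le> (norm (f x))\<^sup>2 + (norm (g x))\<^sup>2" for x
  proof -
    have "2 * (norm (f x) * norm (g x)) \<le> (norm (f x))\<^sup>2 + (norm (g x))\<^sup>2"
      using sum_squares_bound[of "norm (f x)" "norm (g x)"] by simp
    moreover have "0 \<le> norm (f x) * norm (g x)" by simp
    ultimately show ?thesis by (simp only: norm_mult complex_mod_cnj)
  qed
  then show "AE x in M. norm (f x * cnj (g x)) \<le> norm (norm (f x) powr 2 + norm (g x) powr 2)"
    by (intro AE_I2) simp
qed measurable

lemma L2_inner_add_left: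
  "in_Lp 2 f \<Longrightarrow> in_Lp 2 g \<Longrightarrow> in_Lp 2 h \<Longrightarrow> L2_inner (f + g) h = L2_inner f h + L2_inner g h"
  by transfer (simp add: ae_eq_def integrable_mult_cnj distrib_right)

lemma L2_inner_scale_left: "L2_inner (scale_ae c f) g = c * L2_inner f g"
  by transfer (simp add: mult.assoc)

lemma L2_inner_cnj: "cnj (L2_inner f g) = L2_inner g f"
  by transfer (simp add: mult.commute flip: Bochner_Integration.integral_cnj)

lemma L2_inner_self: "L2_inner f f = of_real ((Lp_norm 2 f)\<^sup>2)"
proof transfer
  fix f :: "real \<Rightarrow> complex"
  have "(LINT x|unit_leb. f x * cnj (f x)) = (LINT x|unit_leb. complex_of_real ((norm (f x))\<^sup>2))"
    by (simp only: complex_norm_square)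
  also have "\<dots> = of_real (LINT x|unit_leb. (norm (f x))\<^sup>2)"
    by (rule integral_complex_of_real)
  finally show "(LINT x|unit_leb. f x * cnj (f x))
    = of_real (((LINT x|unit_leb. norm (f x) powr 2) powr (1 / 2))\<^sup>2)"
    by (simp add: powr_half_sqrt)
qed

lemma L2_inner_zero_left: "L2_inner 0 g = 0"
  by transfer simp

lemma L2_inner_diff_left:
  assumes "in_Lp 2 f" "in_Lp 2 g" "in_Lp 2 h"
  shows "L2_inner (f - g) h = L2_inner f h - L2_inner g h"
  using L2_inner_add_left[of "f - g" g h] assms by (simp add: in_Lp_diff)

lemma L2_inner_diff_right:
  assumes "in_Lp 2 f" "in_Lp 2 g" "in_Lp 2 h"
  shows "L2_inner f (g - h) = L2_inner f g - L2_inner f h"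
  using L2_inner_diff_left[OF assms(2,3,1)] by (metis L2_inner_cnj complex_cnj_diff)

lemma in_Lp_sum:
  "p \<ge> 1 \<Longrightarrow> (\<And>i. i \<in> A \<Longrightarrow> in_Lp p (f i)) \<Longrightarrow> in_Lp p (\<Sum>i\<in>A. f i)"
  by (induction A rule: infinite_finite_induct) (auto simp: in_Lp_zero in_Lp_add)

lemma L2_inner_sum_left:
  assumes "\<And>i. i \<in> A \<Longrightarrow> in_Lp 2 (f i)" "in_Lp 2 g"
  shows "L2_inner (\<Sum>i\<in>A. f i) g = (\<Sum>i\<in>A. L2_inner (f i) g)"
  using assms
  by (induction A rule: infinite_finite_induct)
    (auto simp: L2_inner_zero_left L2_inner_add_left in_Lp_sum)

section \<open>Orthonormality of the Walsh functions\<close>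

text \<open>On each interval of length \<open>2 * h\<close> the two halves cancel.\<close>

lemma has_integral_antiperiodic:
  fixes f :: "real \<Rightarrow> real"
  assumes h: "h \<ge> 0" and anti: "\<And>x. f (x + h) = - f x"
    and int: "\<And>a b. f integrable_on {a..b}"
  shows "(f has_integral 0) {a..a + 2 * h * real m}"
proof (induction m)
  case 0
  then show ?case using has_integral_refl(2)[of f a] by simp
next
  case (Suc m)
  define c where "c = a + 2 * h * real m"
  obtain I where I: "(f has_integral I) {c..c + h}" using int by blast
  have "((\<lambda>x. f (x + h)) has_integral - I) {c..c + h}"
    unfolding anti by (intro has_integral_neg I)
  then have "(f has_integral - I) {c + h..c + 2 * h}"
    using has_integral_shift_real_ivl[of "\<lambda>x. f (x + h)" "- I" c "c + h" "- h"] by (simp add: algebra_simps)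
  from has_integral_combine[OF _ _ I this] h
  have "(f has_integral 0) {c..c + 2 * h}" by simp
  from has_integral_combine[OF _ _ Suc[folded c_def] this] h
  show ?case by (simp add: c_def algebra_simps)
qed

lemma rademacher_antiperiodic: "rademacher k (x + 1 / 2 ^ (k + 1)) = - rademacher k x"
  by (simp add: rademacher_def distrib_left sgn_minus)

lemma rademacher_periodic:
  assumes "k < j"
  shows "rademacher j (x + 1 / 2 ^ (k + 1)) = rademacher j x"
proof -
  from assms obtain i where j: "j = Suc (k + i)" by (auto dest: less_imp_Suc_add)
  have "(2::real) ^ (j + 1) * pi * (x + 1 / 2 ^ (k + 1)) = 2 ^ (j + 1) * pi * x + real (2 ^ i) * (2 * pi)"
    by (simp add: j field_simps power_add)
  also have "sin \<dots> = sin (2 ^ (j + 1) * pi * x)"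
    using sin.plus_of_nat[of "2 ^ (j + 1) * pi * x" "2 ^ i"] by simp
  finally show ?thesis by (simp add: rademacher_def)
qed

lemma abs_walsh_le_1: "\<bar>walsh n x\<bar> \<le> 1"
  unfolding walsh_def abs_prod
  by (intro prod_le_1) (auto simp: rademacher_def abs_sgn_eq)

lemma integrable_walsh: "walsh n integrable_on {a..b}"
proof -
  have "walsh n \<in> borel_measurable borel"
    unfolding walsh_def rademacher_def by measurable
  then have "walsh n \<in> borel_measurable lebesgue"
    by (intro measurable_completion) simp
  then show ?thesis
    using measurable_bounded_lemma[of "walsh n" "\<lambda>_. 1" a b] abs_walsh_le_1 by auto
qed

text \<open>The shift is by half a period of the lowest Rademacher factor \<open>k\<close> of the Walsh function. All
  other factors oscillate faster, and the shift is a multiple of their periods, so only factor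
  \<open>k\<close> notices it, by changing its sign. With the highest factor instead, the slower ones
  would not be invariant.\<close>

lemma walsh_antiperiodic:
  assumes "bit n k" "\<And>j. j < k \<Longrightarrow> \<not> bit n j"
  shows "walsh n (x + 1 / 2 ^ (k + 1)) = - walsh n x"
proof -
  have split: "walsh n y = rademacher k y * (\<Prod>j\<in>{j. bit n j} - {k}. rademacher j y)" for y
    unfolding walsh_def using assms(1) by (intro prod.remove finite_bits) simp
  have "(\<Prod>j\<in>{j. bit n j} - {k}. rademacher j (x + 1 / 2 ^ (k + 1)))
    = (\<Prod>j\<in>{j. bit n j} - {k}. rademacher j x)"
    using assms(2) by (intro prod.cong refl rademacher_periodic) (auto intro: linorder_neqE_nat)
  then show ?thesis unfolding split rademacher_antiperiodic by simp
qed

lemma integral_walsh: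
  assumes "n \<noteq> 0"
  shows "(LINT x|unit_leb. walsh n x) = 0"
proof -
  obtain k where k: "bit n k" "\<And>j. j < k \<Longrightarrow> \<not> bit n j"
    using assms exists_least_iff[of "bit n"] by (auto simp: bit_eq_iff)
  \<comment> \<open>The unit interval consists of \<open>2 ^ k\<close> full periods of the lowest factor.\<close>
  have "(walsh n has_integral 0) {0..0 + 2 * (1 / 2 ^ (k + 1)) * real (2 ^ k)}"
    using walsh_antiperiodic[OF k] integrable_walsh by (intro has_integral_antiperiodic) auto
  then have "(walsh n has_integral 0) {0..1}" by simp
  moreover have "integrable unit_leb (walsh n)"
    by (rule integrable_bounded_unit_leb[where B = 1]) (auto simp: abs_walsh_le_1)
  ultimately show ?thesis by (simp add: lebesgue_integral_eq_integral integral_unique)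
qed

text \<open>A Rademacher function vanishes only at dyadic rationals.\<close>

lemma AE_rademacher_squared: "AE x in unit_leb. \<forall>k. rademacher k x * rademacher k x = 1"
proof -
  let ?Z = "range (\<lambda>(i::int, k). i / 2 ^ (k + 1)) :: real set"
  have "x \<in> ?Z" if x: "rademacher k x * rademacher k x \<noteq> 1" for x k
  proof -
    from x have "sin (2 ^ (k + 1) * pi * x) = 0"
      by (auto simp: rademacher_def sgn_if split: if_splits)
    then obtain i :: int where "2 ^ (k + 1) * pi * x = of_int i * pi" by (auto simp: sin_zero_iff_int2)
    then have "x = i / 2 ^ (k + 1)" by (simp add: field_simps)
    then show ?thesis by (intro image_eqI[of _ _ "(i, k)"]) auto
  qed
  moreover have "?Z \<in> null_sets lebesgue"
    by (intro null_sets_completionI countable_imp_null_set_lborel) simp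
  ultimately have "AE x in lebesgue. \<forall>k. rademacher k x * rademacher k x = 1"
    by (intro AE_I'[of ?Z]) auto
  then show ?thesis by (auto simp: AE_restrict_space_iff elim: AE_mp)
qed

text \<open>Common Rademacher factors square to one, so the binary digits add without carry.\<close>

lemma walsh_mult: "AE x in unit_leb. walsh n x * walsh m x = walsh (xor n m) x"
  using AE_rademacher_squared
proof eventually_elim
  case (elim x)
  let ?r = "\<lambda>k. rademacher k x"
  let ?A = "{k. bit n k}" and ?B = "{k. bit m k}"
  have fin: "finite ?A" "finite ?B" by (rule finite_bits)+
  have "walsh n x * walsh m x = (prod ?r (?A - ?B) * prod ?r (?A \<inter> ?B)) * (prod ?r (?B - ?A) * prod ?r (?A \<inter> ?B))"
    using prod.Int_Diff[OF fin(1), of ?r ?B] prod.Int_Diff[OF fin(2), of ?r ?A]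
    by (simp add: walsh_def Int_commute mult.commute)
  also have "\<dots> = prod ?r (?A - ?B) * prod ?r (?B - ?A) * (\<Prod>k\<in>?A \<inter> ?B. ?r k * ?r k)"
    by (simp add: prod.distrib ac_simps)
  also have "\<dots> = prod ?r ((?A - ?B) \<union> (?B - ?A))"
    using elim fin by (subst prod.union_disjoint) auto
  also have "(?A - ?B) \<union> (?B - ?A) = {k. bit (xor n m) k}"
    by (auto simp: bit_xor_iff)
  finally show ?case by (simp add: walsh_def)
qed

lemma in_Lp_walsh: "p \<ge> 0 \<Longrightarrow> in_Lp p (walsh_ae n)"
proof transfer
  fix p :: real and n assume "p \<ge> 0"
  then show "integrable unit_leb (\<lambda>x. norm (complex_of_real (walsh n x)) powr p)"
    by (intro integrable_bounded_unit_leb[where B = 1]) (auto intro!: powr_le1 simp: abs_walsh_le_1)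
qed

lemma walsh_coeff_eq_L2_inner: "walsh_coeff f n = L2_inner f (walsh_ae n)"
  by transfer simp

lemma L2_inner_walsh: "L2_inner (walsh_ae n) (walsh_ae m) = (if n = m then 1 else 0)"
proof transfer
  fix n m
  have "(LINT x|unit_leb. complex_of_real (walsh n x) * cnj (complex_of_real (walsh m x)))
    = (LINT x|unit_leb. complex_of_real (walsh n x * walsh m x))"
    by simp
  also have "\<dots> = of_real (LINT x|unit_leb. walsh n x * walsh m x)"
    by (rule integral_complex_of_real)
  also have "(LINT x|unit_leb. walsh n x * walsh m x) = (LINT x|unit_leb. walsh (xor n m) x)"
    by (intro integral_cong_AE walsh_mult) measurable
  also have "\<dots> = (if n = m then 1 else 0)"
  proof (cases "n = m")
    case True
    then show ?thesis by (simp add: walsh_def measure_restrict_space)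
  next
    case False
    then have "xor n m \<noteq> 0" by (auto simp: bit_eq_iff bit_xor_iff)
    then show ?thesis using False by (simp add: integral_walsh)
  qed
  finally show "(LINT x|unit_leb. complex_of_real (walsh n x) * cnj (complex_of_real (walsh m x)))
    = (if n = m then 1 else 0)" by simp
qed

lemma Lp_norm_walsh_le_1:
  assumes "p > 0" shows "Lp_norm p (walsh_ae n) \<le> 1"
  using assms
proof transfer
  fix p :: real and n assume p: "p > 0"
  have "(LINT x|unit_leb. norm (complex_of_real (walsh n x)) powr p) \<le> (LINT x|unit_leb. 1)"
    using p abs_walsh_le_1 by (intro integral_mono integrable_bounded_unit_leb[where B = 1]) (auto intro!: powr_le1)
  also have "\<dots> = 1" by (simp add: measure_restrict_space)
  finally show "(LINT x|unit_leb. norm (complex_of_real (walsh n x)) powr p) powr (1 / p) \<le> 1"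
    using p by (intro powr_le1) auto
qed

section \<open>Parseval and Bessel\<close>

lemma in_Lp_walsh_sum:
  "p \<ge> 1 \<Longrightarrow> in_Lp p (\<Sum>n\<in>A. scale_ae (c n) (walsh_ae n))"
  by (intro in_Lp_sum in_Lp_scale in_Lp_walsh) auto

lemma L2_inner_walsh_sum:
  assumes "in_Lp 2 g"
  shows "L2_inner (\<Sum>n\<in>A. scale_ae (c n) (walsh_ae n)) g = (\<Sum>n\<in>A. c n * cnj (walsh_coeff g n))"
  using assms
  by (simp add: L2_inner_sum_left in_Lp_scale in_Lp_walsh L2_inner_scale_left
      walsh_coeff_eq_L2_inner L2_inner_cnj)

lemma walsh_coeff_walsh_sum:
  assumes "finite A"
  shows "walsh_coeff (\<Sum>n\<in>A. scale_ae (c n) (walsh_ae n)) m = (if m \<in> A then c m else 0)"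
  using assms
  by (simp add: walsh_coeff_eq_L2_inner L2_inner_sum_left in_Lp_scale in_Lp_walsh
      L2_inner_scale_left L2_inner_walsh if_distrib[of "\<lambda>t. _ * t"] cong: if_cong)

text \<open>Both bounds on multipliers below come from orthonormality: Parseval turns the norms of finite
  Walsh sums into sums of squares, and Bessel bounds the coefficients of an arbitrary function.\<close>

lemma Parseval_walsh_sum:
  assumes "finite A"
  shows "(Lp_norm 2 (\<Sum>n\<in>A. scale_ae (c n) (walsh_ae n)))\<^sup>2 = (\<Sum>n\<in>A. (norm (c n))\<^sup>2)"
proof -
  let ?S = "\<Sum>n\<in>A. scale_ae (c n) (walsh_ae n)"
  have "complex_of_real ((Lp_norm 2 ?S)\<^sup>2) = L2_inner ?S ?S" by (simp only: L2_inner_self)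
  also have "\<dots> = (\<Sum>n\<in>A. c n * cnj (c n))"
    using assms by (simp add: L2_inner_walsh_sum in_Lp_walsh_sum walsh_coeff_walsh_sum)
  also have "\<dots> = complex_of_real (\<Sum>n\<in>A. (norm (c n))\<^sup>2)"
    by (simp only: complex_norm_square of_real_sum)
  finally show ?thesis by (simp only: of_real_eq_iff)
qed

lemma Bessel_inequality:
  assumes f: "in_Lp 2 f" and A: "finite A"
  shows "(\<Sum>n\<in>A. (norm (walsh_coeff f n))\<^sup>2) \<le> (Lp_norm 2 f)\<^sup>2"
proof -
  let ?S = "\<Sum>n\<in>A. scale_ae (walsh_coeff f n) (walsh_ae n)"
  let ?B = "\<Sum>n\<in>A. (norm (walsh_coeff f n))\<^sup>2"
  have S: "in_Lp 2 ?S" by (rule in_Lp_walsh_sum) simp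
  have Sf: "L2_inner ?S f = of_real ?B"
    by (simp only: L2_inner_walsh_sum[OF f] complex_norm_square of_real_sum)
  have fS: "L2_inner f ?S = of_real ?B"
    using arg_cong[OF Sf, of cnj] by (simp only: L2_inner_cnj complex_cnj_complex_of_real)
  have SS: "L2_inner ?S ?S = of_real ?B"
    by (simp only: L2_inner_self Parseval_walsh_sum[OF A])
  have "complex_of_real ((Lp_norm 2 (f - ?S))\<^sup>2) = L2_inner (f - ?S) (f - ?S)"
    by (simp only: L2_inner_self)
  also have "\<dots> = L2_inner f f - L2_inner f ?S - (L2_inner ?S f - L2_inner ?S ?S)"
    using f S by (simp add: L2_inner_diff_left L2_inner_diff_right in_Lp_diff)
  also have "\<dots> = complex_of_real ((Lp_norm 2 f)\<^sup>2 - ?B)"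
    by (simp only: Sf fS SS L2_inner_self[of f] of_real_diff) simp
  finally have "(Lp_norm 2 (f - ?S))\<^sup>2 = (Lp_norm 2 f)\<^sup>2 - ?B" by (simp only: of_real_eq_iff)
  then show ?thesis using zero_le_power2[of "Lp_norm 2 (f - ?S)"] by linarith
qed

section \<open>Walsh multipliers into \<open>L\<^sup>2\<close>\<close>

text \<open>The partial sums of a multiplier are explicit finite sums while \<open>T f\<close> is only their limit;
  this lemma passes estimates from the former to the latter.\<close>

lemma Lp_norm_limit_le:
  assumes q: "q \<ge> 1" and lim: "(\<lambda>N. Lp_norm q (S N - g)) \<longlonglongrightarrow> 0" and g: "in_Lp q g"
    and S: "\<And>N. in_Lp q (S N)" and h: "in_Lp q h" and le: "\<forall>\<^sub>F N in sequentially. Lp_norm q (S N - h) \<le> B"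
  shows "Lp_norm q (g - h) \<le> B"
proof (rule tendsto_le[OF _ _ tendsto_const])
  show "(\<lambda>N. Lp_norm q (S N - g) + B) \<longlonglongrightarrow> B" using tendsto_add[OF lim tendsto_const[of B]] by simp
  show "\<forall>\<^sub>F N in sequentially. Lp_norm q (g - h) \<le> Lp_norm q (S N - g) + B"
    using le
  proof eventually_elim
    case (elim N)
    have "Lp_norm q ((g - S N) + (S N - h)) \<le> Lp_norm q (g - S N) + Lp_norm q (S N - h)"
      by (intro Lp_norm_triangle q in_Lp_diff g S h)
    then show ?case using elim by (simp add: Lp_norm_minus_commute[of q g "S N"])
  qed
qed simp

text \<open>By orthonormality the partial sums are constant from index \<open>n + 1\<close> on, so this constant
  is their limit.\<close>

lemma multiplier_walsh:
  assumes q: "q \<ge> 1" and p: "p \<ge> 0" and T: "bounded_walsh_multiplier p q a T"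
  shows "T (walsh_ae n) = scale_ae (a n) (walsh_ae n)"
proof -
  let ?w = "walsh_ae n"
  have w: "?w \<in> Lp p" using p by (simp add: Lp_def in_Lp_walsh)
  have Tw: "in_Lp q (T ?w)"
    using T w by (auto simp: bounded_walsh_multiplier_def bounded_linear_Lp_def Lp_def)
  have aw: "in_Lp q (scale_ae (a n) ?w)" using q by (intro in_Lp_scale in_Lp_walsh) simp
  have "multiplier_partial_sum a ?w N = scale_ae (a n) ?w" if "n < N" for N
  proof -
    have "multiplier_partial_sum a ?w N = (\<Sum>m<N. if m = n then scale_ae (a n) ?w else 0)"
      unfolding multiplier_partial_sum_def
      by (intro sum.cong refl) (auto simp: walsh_coeff_eq_L2_inner L2_inner_walsh)
    then show ?thesis using that by simp
  qed
  then have "\<forall>\<^sub>F N in sequentially. Lp_norm q (multiplier_partial_sum a ?w N - T ?w)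
      = Lp_norm q (scale_ae (a n) ?w - T ?w)"
    unfolding eventually_sequentially by (intro exI[of _ "Suc n"]) auto
  moreover have "(\<lambda>N. Lp_norm q (multiplier_partial_sum a ?w N - T ?w)) \<longlonglongrightarrow> 0"
    using T w by (simp add: bounded_walsh_multiplier_def)
  ultimately have "(\<lambda>N. Lp_norm q (scale_ae (a n) ?w - T ?w)) \<longlonglongrightarrow> 0"
    using tendsto_cong by fast
  then have "Lp_norm q (scale_ae (a n) ?w - T ?w) = 0" by (simp add: LIMSEQ_const_iff)
  then show ?thesis using Lp_norm_zero_iff[OF q in_Lp_diff[OF q aw Tw]] by simp
qed

text \<open>The operator minus its first \<open>N\<close> terms multiplies only coefficients with index at least \<open>N\<close>, so in
  \<open>L\<^sup>2\<close> it has norm at most the supremum of the remaining symbol values. The assumption \<open>2 \<le> p\<close>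
  enters through Bessel's inequality, since the unit ball of \<open>L\<^sup>p\<close> lies in that of \<open>L\<^sup>2\<close>.\<close>

lemma multiplier_tail_bound:
  assumes T: "bounded_walsh_multiplier p 2 a T" and p: "2 \<le> p"
    and f: "in_Lp p f" "Lp_norm p f \<le> 1" and tail: "\<And>n. N \<le> n \<Longrightarrow> norm (a n) \<le> e" and e: "0 \<le> e"
  shows "Lp_norm 2 (T f - multiplier_partial_sum a f N) \<le> e"
proof (rule Lp_norm_limit_le)
  have f2: "in_Lp 2 f" and le1: "Lp_norm 2 f \<le> 1"
    using in_Lp_exponent_mono[of 2 p f] Lp_norm_exponent_mono[of 2 p f] p f by auto
  show "(\<lambda>M. Lp_norm 2 (multiplier_partial_sum a f M - T f)) \<longlonglongrightarrow> 0" "in_Lp 2 (T f)"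
    using T f by (auto simp: bounded_walsh_multiplier_def bounded_linear_Lp_def Lp_def)
  show mem: "in_Lp 2 (multiplier_partial_sum a f M)" for M
    unfolding multiplier_partial_sum_def by (rule in_Lp_walsh_sum) simp
  show "in_Lp 2 (multiplier_partial_sum a f N)" by (rule mem)
  have "Lp_norm 2 (multiplier_partial_sum a f M - multiplier_partial_sum a f N) \<le> e" if "N \<le> M" for M
  proof -
    have "multiplier_partial_sum a f M - multiplier_partial_sum a f N
        = (\<Sum>n\<in>{N..<M}. scale_ae (a n * walsh_coeff f n) (walsh_ae n))"
      unfolding multiplier_partial_sum_def lessThan_atLeast0
      using that by (intro sum_diff_nat_ivl) auto
    then have "(Lp_norm 2 (multiplier_partial_sum a f M - multiplier_partial_sum a f N))\<^sup>2
        = (\<Sum>n\<in>{N..<M}. (norm (a n))\<^sup>2 * (norm (walsh_coeff f n))\<^sup>2)"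
      by (simp add: Parseval_walsh_sum norm_mult power_mult_distrib)
    also have "\<dots> \<le> (\<Sum>n\<in>{N..<M}. e\<^sup>2 * (norm (walsh_coeff f n))\<^sup>2)"
      using tail by (intro sum_mono mult_right_mono power_mono) auto
    also have "\<dots> = e\<^sup>2 * (\<Sum>n\<in>{N..<M}. (norm (walsh_coeff f n))\<^sup>2)"
      by (rule sum_distrib_left[symmetric])
    also have "\<dots> \<le> e\<^sup>2 * (Lp_norm 2 f)\<^sup>2"
      by (intro mult_left_mono Bessel_inequality f2) auto
    also have "\<dots> \<le> e\<^sup>2 * 1"
      by (intro mult_left_mono power_le_one le1 Lp_norm_nonneg) auto
    finally have "(Lp_norm 2 (multiplier_partial_sum a f M - multiplier_partial_sum a f N))\<^sup>2 \<le> e\<^sup>2"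
      by simp
    then show ?thesis using e by (rule power2_le_imp_le)
  qed
  then show "\<forall>\<^sub>F M in sequentially.
      Lp_norm 2 (multiplier_partial_sum a f M - multiplier_partial_sum a f N) \<le> e"
    unfolding eventually_sequentially by (intro exI[of _ N]) simp
qed simp

section \<open>Total boundedness and compact operators\<close>

text \<open>Walsh sums of a fixed length with bounded coefficients form a bounded part of a
  finite-dimensional space. A net for them is obtained by picking every coefficient from a finite
  net of a disc in the complex plane.\<close>

lemma walsh_sum_finite_net:
  assumes q: "q \<ge> 1" and e: "e > 0"
  obtains K where "finite K" "\<And>g. g \<in> K \<Longrightarrow> in_Lp q g"
    "\<And>c. (\<And>n. n < N \<Longrightarrow> norm (c n) \<le> R) \<Longrightarrow>
      \<exists>g\<in>K. Lp_norm q ((\<Sum>n<N. scale_ae (c n) (walsh_ae n)) - g) \<le> e"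
proof -
  \<comment> \<open>An error \<open>d\<close> in each of the \<open>N\<close> coefficients adds up to at most \<open>e\<close>; the summand \<open>1\<close> covers \<open>N = 0\<close>.\<close>
  define d where "d = e / (real N + 1)"
  have d: "d > 0" using e by (simp add: d_def)
  have Nd: "real N * d \<le> e" using e by (simp add: d_def pos_divide_le_eq distrib_left mult.commute)
  obtain D :: "complex set" where D: "finite D" "cball 0 R \<subseteq> (\<Union>z\<in>D. ball z d)"
    using compact_cball[of "0::complex" R] d unfolding compact_eq_totally_bounded by blast
  let ?sum = "\<lambda>c. \<Sum>n<N. scale_ae (c n) (walsh_ae n)"
  show thesis
  proof
    show "finite (?sum ` PiE {..<N} (\<lambda>_. D))" using D(1) by (intro finite_imageI finite_PiE) auto
    show "in_Lp q g" if "g \<in> ?sum ` PiE {..<N} (\<lambda>_. D)" for g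
      using that in_Lp_walsh_sum[OF q] by auto
    fix c :: "nat \<Rightarrow> complex" assume c: "\<And>n. n < N \<Longrightarrow> norm (c n) \<le> R"
    have "\<exists>z\<in>D. norm (c n - z) \<le> d" if "n < N" for n
    proof -
      have "c n \<in> cball 0 R" using c[OF that] by simp
      then obtain z where "z \<in> D" "c n \<in> ball z d" using D(2) by blast
      then show ?thesis by (intro bexI[of _ z]) (auto simp: dist_norm norm_minus_commute)
    qed
    then obtain z where z: "z n \<in> D" "norm (c n - z n) \<le> d" if "n < N" for n by metis
    define b where "b = restrict z {..<N}"
    have "?sum c - ?sum b = (\<Sum>n<N. scale_ae (c n - b n) (walsh_ae n))"
      by (simp add: sum_subtractf ae_fun.scale_left_diff_distrib)
    moreover have "Lp_norm q (\<Sum>n<M. scale_ae (c n - b n) (walsh_ae n)) \<le> real M * d" if "M \<le> N" for M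
      using that
    proof (induction M)
      case 0
      then show ?case using q Lp_norm_zero_iff[OF q in_Lp_zero] by simp
    next
      case (Suc M)
      have "Lp_norm q (scale_ae (c M - b M) (walsh_ae M)) \<le> d * 1"
        unfolding Lp_norm_scale[OF q]
        using Suc.prems z q Lp_norm_walsh_le_1 d Lp_norm_nonneg
        by (intro mult_mono) (auto simp: b_def)
      moreover have "Lp_norm q (\<Sum>n<M. scale_ae (c n - b n) (walsh_ae n)) \<le> real M * d"
        using Suc by simp
      moreover have "Lp_norm q ((\<Sum>n<M. scale_ae (c n - b n) (walsh_ae n)) + scale_ae (c M - b M) (walsh_ae M))
          \<le> Lp_norm q (\<Sum>n<M. scale_ae (c n - b n) (walsh_ae n)) + Lp_norm q (scale_ae (c M - b M) (walsh_ae M))"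
        using q by (intro Lp_norm_triangle in_Lp_walsh_sum in_Lp_scale in_Lp_walsh) auto
      ultimately show ?case by (simp add: distrib_right)
    qed
    ultimately have "Lp_norm q (?sum c - ?sum b) \<le> e" using Nd by force
    moreover have "b \<in> PiE {..<N} (\<lambda>_. D)" using z by (auto simp: b_def)
    ultimately show "\<exists>g\<in>?sum ` PiE {..<N} (\<lambda>_. D). Lp_norm q (?sum c - g) \<le> e" by blast
  qed
qed

text \<open>Total boundedness asks for centres inside the set itself. Centres elsewhere in the space are
  as good: each ball that meets the set lies in the ball of twice the radius around one of its
  points in the set.\<close>

lemma (in Metric_space) mtotally_bounded_if_nets:
  assumes S: "S \<subseteq> M"
    and net: "\<And>e. 0 < e \<Longrightarrow> \<exists>K. finite K \<and> K \<subseteq> M \<and> S \<subseteq> (\<Union>x\<in>K. mball x e)"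
  shows "mtotally_bounded S"
  unfolding mtotally_bounded_def
proof (intro allI impI)
  fix e :: real assume "0 < e"
  then obtain K where K: "finite K" "K \<subseteq> M" "S \<subseteq> (\<Union>x\<in>K. mball x (e/2))"
    using net[of "e/2"] by auto
  define K' where "K' = {x \<in> K. S \<inter> mball x (e/2) \<noteq> {}}"
  have "\<forall>x\<in>K'. \<exists>y. y \<in> S \<inter> mball x (e/2)" by (auto simp: K'_def)
  then obtain y where y: "\<And>x. x \<in> K' \<Longrightarrow> y x \<in> S \<inter> mball x (e/2)" by metis
  have "S \<subseteq> (\<Union>z\<in>y ` K'. mball z e)"
  proof
    fix s assume s: "s \<in> S"
    then obtain x where x: "x \<in> K" "s \<in> mball x (e/2)" using K(3) by blast
    then have "x \<in> K'" using s by (auto simp: K'_def)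
    then have yx: "y x \<in> mball x (e/2)" using y by blast
    have "d (y x) s \<le> d (y x) x + d x s"
      using triangle[of "y x" x s] x yx by simp
    then have "d (y x) s < e" using x(2) yx commute[of "y x" x] by auto
    then have "s \<in> mball (y x) e" using x yx by auto
    then show "s \<in> (\<Union>z\<in>y ` K'. mball z e)" using \<open>x \<in> K'\<close> by blast
  qed
  moreover have "finite (y ` K')" "y ` K' \<subseteq> S" using K(1) y by (auto simp: K'_def)
  ultimately show "\<exists>K. finite K \<and> K \<subseteq> S \<and> S \<subseteq> (\<Union>x\<in>K. mball x e)" by blast
qed

lemma compact_operator_Lp_iff_totally_bounded:
  assumes q: "q \<ge> 1" and T: "\<And>f. f \<in> Lp p \<Longrightarrow> T f \<in> Lp q"
  shows "compact_operator_Lp p q T \<longleftrightarrow>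
    Metric_space.mtotally_bounded (Lp q) (\<lambda>f g. Lp_norm q (f - g)) (T ` {f \<in> Lp p. Lp_norm p f \<le> 1})"
proof -
  have S: "T ` {f \<in> Lp p. Lp_norm p f \<le> 1} \<subseteq> Lp q" using T by auto
  show ?thesis
    using Metric_space.mtotally_bounded_eq_compact_closure_of[OF Metric_space_Lp[OF q] mcomplete_Lp[OF q]] S
    unfolding compact_operator_Lp_def Lp_topology_def by blast
qed

section \<open>Compactness of multipliers\<close>

theorem theorem3p3:
  fixes p :: real and a :: "nat \<Rightarrow> complex" and T :: "ae_fun \<Rightarrow> ae_fun"
  assumes "2 < p"
    and "bounded_walsh_multiplier p 2 a T"
  shows "compact_operator_Lp p 2 T \<longleftrightarrow> a \<longlonglongrightarrow> 0"
proof -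
  interpret Metric_space "Lp 2" "\<lambda>f g. Lp_norm 2 (f - g)" by (rule Metric_space_Lp) simp
  let ?S = "T ` {f \<in> Lp p. Lp_norm p f \<le> 1}"
  have maps: "T f \<in> Lp 2" if "f \<in> Lp p" for f
    using assms(2) that by (auto simp: bounded_walsh_multiplier_def bounded_linear_Lp_def)
  have "compact_operator_Lp p 2 T \<longleftrightarrow> mtotally_bounded ?S"
    using maps by (intro compact_operator_Lp_iff_totally_bounded) auto
  also have "\<dots> \<longleftrightarrow> a \<longlonglongrightarrow> 0"
  proof
    assume tb: "mtotally_bounded ?S"
    show "a \<longlonglongrightarrow> 0"
    proof (rule ccontr)
      assume "\<not> a \<longlonglongrightarrow> 0"
      then obtain e where e: "e > 0" "\<And>N. \<exists>n\<ge>N. e \<le> norm (a n)"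
        by (auto simp: LIMSEQ_iff not_less)
      define I where "I = {n. e \<le> norm (a n)}"
      have "infinite I" using e(2) by (auto simp: I_def infinite_nat_iff_unbounded_le)
      obtain K where K: "finite K" "?S \<subseteq> (\<Union>x\<in>K. mball x (e/2))"
        using tb e(1) unfolding mtotally_bounded_def by (meson half_gt_zero)
      have "walsh_ae n \<in> {f \<in> Lp p. Lp_norm p f \<le> 1}" for n
        using assms(1) by (simp add: Lp_def in_Lp_walsh Lp_norm_walsh_le_1)
      then have "\<exists>x\<in>K. T (walsh_ae n) \<in> mball x (e/2)" for n
        using K(2) by (meson UN_E image_eqI subsetD)
      then have "\<forall>n\<in>I. \<exists>x\<in>K. T (walsh_ae n) \<in> mball x (e/2)" by blast
      from pigeonhole_infinite_rel[OF \<open>infinite I\<close> K(1) this]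
      \<comment> \<open>Infinitely many points in finitely many balls: two of them share a ball.\<close>
      obtain x where x: "infinite {n \<in> I. T (walsh_ae n) \<in> mball x (e/2)}" (is "infinite ?X") by blast
      obtain n where n: "n \<in> ?X" using infinite_imp_nonempty[OF x] by blast
      obtain m where m: "m \<in> ?X - {n}" using infinite_imp_nonempty[OF infinite_remove[OF x]] by blast
      from n m have nm: "n \<noteq> m" "n \<in> I" "T (walsh_ae n) \<in> mball x (e/2)" "T (walsh_ae m) \<in> mball x (e/2)"
        by auto
      \<comment> \<open>A difference of two multiplied Walsh functions, read as a single Walsh sum.\<close>
      define c where "c = a(m := - a m)"
      have "T (walsh_ae n) - T (walsh_ae m) = (\<Sum>k\<in>{n, m}. scale_ae (c k) (walsh_ae k))"
        using nm(1) assms by (simp add: multiplier_walsh[OF _ _ assms(2)] c_def)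
      then have "(Lp_norm 2 (T (walsh_ae n) - T (walsh_ae m)))\<^sup>2 = (norm (a n))\<^sup>2 + (norm (a m))\<^sup>2"
        using nm(1) Parseval_walsh_sum[of "{n, m}" c] by (simp add: c_def)
      moreover have "e\<^sup>2 \<le> (norm (a n))\<^sup>2" using nm(2) e(1) by (intro power_mono) (auto simp: I_def)
      moreover have "0 \<le> (norm (a m))\<^sup>2" by simp
      ultimately have "e\<^sup>2 \<le> (Lp_norm 2 (T (walsh_ae n) - T (walsh_ae m)))\<^sup>2" by linarith
      then have "e \<le> Lp_norm 2 (T (walsh_ae n) - T (walsh_ae m))"
        by (rule power2_le_imp_le) (rule Lp_norm_nonneg)
      moreover have "Lp_norm 2 (T (walsh_ae n) - T (walsh_ae m)) < e"
        using triangle[of "T (walsh_ae n)" x "T (walsh_ae m)"] nm(3,4)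
        by (simp add: Lp_norm_minus_commute[of 2 x])
      ultimately show False by simp
    qed
  next
    assume lim: "a \<longlonglongrightarrow> 0"
    show "mtotally_bounded ?S"
    proof (rule mtotally_bounded_if_nets)
      show "?S \<subseteq> Lp 2" using maps by auto
      fix e :: real assume e: "0 < e"
      then obtain N where N: "\<And>n. N \<le> n \<Longrightarrow> norm (a n) \<le> e / 4"
        using LIMSEQ_D[OF lim, of "e / 4"] by (auto intro: less_imp_le)
      \<comment> \<open>Any common bound of the first \<open>N\<close> symbol values serves, because the Walsh coefficients of \<open>f\<close> have modulus at most one.\<close>
      define R where "R = (\<Sum>n<N. norm (a n))"
      obtain K where K: "finite K" "\<And>g. g \<in> K \<Longrightarrow> in_Lp 2 g"
        "\<And>c. (\<And>n. n < N \<Longrightarrow> norm (c n) \<le> R) \<Longrightarrow>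
          \<exists>g\<in>K. Lp_norm 2 ((\<Sum>n<N. scale_ae (c n) (walsh_ae n)) - g) \<le> e / 4"
        using walsh_sum_finite_net[of 2 "e / 4" N R] e by auto
      have "T f \<in> (\<Union>x\<in>K. mball x e)" if f: "f \<in> Lp p" "Lp_norm p f \<le> 1" for f
      proof -
        have f2: "in_Lp 2 f" and le1: "Lp_norm 2 f \<le> 1"
          using in_Lp_exponent_mono[of 2 p f] Lp_norm_exponent_mono[of 2 p f] assms(1) f
          by (auto simp: Lp_def)
        have coeff: "norm (walsh_coeff f n) \<le> 1" for n
        proof -
          have "(norm (walsh_coeff f n))\<^sup>2 \<le> (Lp_norm 2 f)\<^sup>2"
            using Bessel_inequality[OF f2, of "{n}"] by simp
          then have "norm (walsh_coeff f n) \<le> Lp_norm 2 f"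
            by (rule power2_le_imp_le) (rule Lp_norm_nonneg)
          then show ?thesis using le1 by simp
        qed
        have "norm (a n * walsh_coeff f n) \<le> R" if "n < N" for n
        proof -
          have "norm (a n * walsh_coeff f n) \<le> norm (a n) * 1"
            unfolding norm_mult by (intro mult_left_mono coeff) simp
          also have "\<dots> \<le> R" unfolding R_def mult_1_right using that by (intro member_le_sum) auto
          finally show ?thesis .
        qed
        then obtain g where g: "g \<in> K" "Lp_norm 2 (multiplier_partial_sum a f N - g) \<le> e / 4"
          using K(3)[of "\<lambda>n. a n * walsh_coeff f n"] unfolding multiplier_partial_sum_def by blast
        have P: "multiplier_partial_sum a f N \<in> Lp 2"
          unfolding multiplier_partial_sum_def Lp_def by (simp add: in_Lp_walsh_sum)
        have "Lp_norm 2 (T f - multiplier_partial_sum a f N) \<le> e / 4"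
          using multiplier_tail_bound[OF assms(2) _ _ f(2) N] assms(1) f(1) e by (simp add: Lp_def)
        then have "Lp_norm 2 (T f - g) < e"
          using triangle[OF maps[OF f(1)] P, of g] K(2)[OF g(1)] g(2) e by (simp add: Lp_def)
        then have "Lp_norm 2 (g - T f) < e" by (simp only: Lp_norm_minus_commute[of 2 g])
        moreover have "g \<in> Lp 2" using K(2)[OF g(1)] by (simp add: Lp_def)
        ultimately show ?thesis using g(1) maps[OF f(1)] by (intro UN_I[of g]) auto
      qed
      then show "\<exists>K. finite K \<and> K \<subseteq> Lp 2 \<and> ?S \<subseteq> (\<Union>x\<in>K. mball x e)"
        using K(1,2) by (intro exI[of _ K]) (auto simp: Lp_def)
    qed
  qed
  finally show ?thesis .
qed

end
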